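(* Let $M^3$ be a conformally flat hypersurface in a space form $M^4_K$, associated to a solution of Lamé's system (with Guichard condition) $l_i(x_1,x_2,x_3)=l_i(\xi)$, with $\xi=\sum_{s=1}^3\alpha_sx_s$ and $\alpha_s\neq0$ for all $s$, given in terms of elliptic functions by $$l_{1,\xi}^2=c_2(c_2-c_1)\Big(l_1^2-\frac{\lambda}{c_2}\Big)\Big(l_1^2-\frac{\lambda}{c_2-c_1}\Big),\quad l_2^2=\frac{c_2}{c_1}\Big(l_1^2-\frac{\lambda}{c_2}\Big),\quad l_3^2=\frac{c_2-c_1}{c_1}\Big(l_1^2-\frac{\lambda}{c_2-c_1}\Big).$$ Then its first fundamental form $g$ is given by $$g=e^{2P(x)}\big\{\cos^2\varphi(\xi)\,(dx_1)^2+(dx_2)^2+\sin^2\varphi(\xi)\,(dx_3)^2\big\},$$ where $\varphi$ satisfies $$\varphi_{,\xi}^2=c\,(a\cos^2\varphi-b),$$ or $g$ is given by $$g=e^{2\tilde P(x)}\big\{\sinh^2\tilde\varphi(\xi)\,(dx_1)^2+\cosh^2\tilde\varphi(\xi)\,(dx_2)^2+(dx_3)^2\big\},$$ where $\tilde\varphi$ satisfies $$\tilde\varphi_{,\xi}^2=c\,(a\cosh^2\tilde\varphi-b),$$ where $a,b,c\in\mathbb{R}\setminus\{0\}$ and $P(x)$, $\tilde P(x)$ are differentiable functions that depend on $l_s$ and $M^4_K$. In both cases, $\xi\in I\subset\mathbb{R}$, where $I$ is an open interval such that $g$ is positive definite.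
   Context: Lamé's system with Guichard condition for positive functions $l_1,l_2,l_3$ of $(x_1,x_2,x_3)$: $l_1^2-l_2^2+l_3^2=0$ and, for $i,j,k$ distinct (subscripts after a comma are derivatives), $$l_{i,x_jx_k}-\frac{l_{i,x_j}l_{j,x_k}}{l_j}-\frac{l_{i,x_k}l_{k,x_j}}{l_k}=0,\qquad \Big(\frac{l_{i,x_j}}{l_j}\Big)_{,x_j}+\Big(\frac{l_{j,x_i}}{l_i}\Big)_{,x_i}+\frac{l_{i,x_k}l_{j,x_k}}{l_k^2}=0.$$ In the solutions considered none of $l_1,l_2,l_3$ is constant; the constants $c_1,c_2,c_3\in\mathbb{R}\setminus\{0\}$ are such that $l_{i,\xi}=c_il_jl_k$ for $i,j,k$ distinct, $c_1-c_2+c_3=0$, $\alpha_1^2c_2c_3+\alpha_2^2c_1c_3+\alpha_3^2c_1c_2=0$, and $\lambda\in\mathbb{R}$. Associated hypersurface: $M^4_K$ is a 4-dimensional space form of curvature $K$. A conformally flat hypersurface $M^3\subset M^4_K$ is generic if it has three distinct principal curvatures. By a theorem of Hertrich-Jeromin, each solution $(l_1,l_2,l_3)$ of Lamé's system with Guichard condition determines, up to conformal equivalence, a generic conformally flat hypersurface in $M^4_K$, with principal coordinates $(x_1,x_2,x_3)$, whose induced metric is $g=e^{2Q(x)}\{l_1^2dx_1^2+l_2^2dx_2^2+l_3^2dx_3^2\}$ for a function $Q$ depending on $M^4_K$; this is the conformally flat hypersurface associated to the solution. *)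

theory Defs
  imports "HOL-Analysis.Analysis"
begin

text \<open>All domains below are open sets, where the derivatives at a point are the usual ones.\<close>

primrec Ck_on :: "nat \<Rightarrow> 'a::euclidean_space set \<Rightarrow> ('a \<Rightarrow> 'b::real_normed_vector) \<Rightarrow> bool" where
  "Ck_on 0 U f \<longleftrightarrow> continuous_on U f"
| "Ck_on (Suc k) U f \<longleftrightarrow> (\<forall>x\<in>U. f differentiable (at x)) \<and>
     (\<forall>b\<in>Basis. Ck_on k U (\<lambda>x. frechet_derivative f (at x) b))"

definition smooth_on :: "'a::euclidean_space set \<Rightarrow> ('a \<Rightarrow> 'b::real_normed_vector) \<Rightarrow> bool" where
  "smooth_on U f \<longleftrightarrow> (\<forall>k. Ck_on k U f)"

definition partial :: "3 \<Rightarrow> (real^3 \<Rightarrow> real) \<Rightarrow> real^3 \<Rightarrow> real" where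
  "partial j f x = frechet_derivative f (at x) (axis j 1)"

definition lame_guichard :: "(real^3) set \<Rightarrow> (3 \<Rightarrow> real^3 \<Rightarrow> real) \<Rightarrow> bool" where
  "lame_guichard U l \<longleftrightarrow>
     (\<forall>i. smooth_on U (l i) \<and> (\<forall>x\<in>U. l i x > 0)) \<and>
     (\<forall>x\<in>U. (l 1 x)\<^sup>2 - (l 2 x)\<^sup>2 + (l 3 x)\<^sup>2 = 0) \<and>
     (\<forall>x\<in>U. \<forall>i j k. i \<noteq> j \<and> j \<noteq> k \<and> i \<noteq> k \<longrightarrow>
        partial k (partial j (l i)) x
          - partial j (l i) x * partial k (l j) x / l j x
          - partial k (l i) x * partial j (l k) x / l k x = 0 \<and>
        partial j (\<lambda>y. partial j (l i) y / l j y) x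
          + partial i (\<lambda>y. partial i (l j) y / l i y) x
          + partial k (l i) x * partial k (l j) x / (l k x)\<^sup>2 = 0)"

text \<open>
  One model of the 4-dimensional space form for every curvature K, as a hypersurface in 5-space
  with points (y, t). For K \<noteq> 0 put t = sqrt |K| * s: then the space form is the quadric
  |y|^2 + sgn K * s^2 = 1/K (a sphere of radius 1 / sqrt K, or the upper sheet of a hyperboloid)
  with the metric induced by |dy|^2 + sgn K * ds^2 = |dy|^2 + dt^2 / K. For K = 0 it is the affine
  hyperplane t = 1; there the convention s / 0 = 0 makes the ambient form |dy|^2, the Euclidean
  metric of that hyperplane.
\<close>

type_synonym ambient = "(real^4) \<times> real"

definition ambient_form :: "real \<Rightarrow> ambient \<Rightarrow> ambient \<Rightarrow> real" where
  "ambient_form K p q = fst p \<bullet> fst q + snd p * snd q / K"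

definition space_form :: "real \<Rightarrow> ambient set" where
  "space_form K = {(y, t). K * (y \<bullet> y) + t\<^sup>2 = 1 \<and> (K \<le> 0 \<longrightarrow> t > 0)}"

definition space_form_tangent :: "real \<Rightarrow> ambient \<Rightarrow> ambient set" where
  "space_form_tangent K p = {v. K * (fst p \<bullet> fst v) + snd p * snd v = 0}"

type_synonym bilinear_field = "real^3 \<Rightarrow> real^3 \<Rightarrow> real^3 \<Rightarrow> real"

definition first_form :: "real \<Rightarrow> (real^3 \<Rightarrow> ambient) \<Rightarrow> bilinear_field" where
  "first_form K f x u v =
     ambient_form K (frechet_derivative f (at x) u) (frechet_derivative f (at x) v)"

text \<open>
  The unit normal N is tangent to the space form, hence orthogonal to the position vector if
  K \<noteq> 0. So pairing N with the ambient second derivative equals pairing it with the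
  covariant derivative of the space form.
\<close>

definition second_form :: "real \<Rightarrow> (real^3 \<Rightarrow> ambient) \<Rightarrow> (real^3 \<Rightarrow> ambient) \<Rightarrow> bilinear_field" where
  "second_form K f N x u v =
     ambient_form K (frechet_derivative (\<lambda>y. frechet_derivative f (at y) u) (at x) v) (N x)"

definition hypersurface ::
  "real \<Rightarrow> (real^3) set \<Rightarrow> (real^3 \<Rightarrow> ambient) \<Rightarrow> (real^3 \<Rightarrow> ambient) \<Rightarrow> bool" where
  "hypersurface K U f N \<longleftrightarrow>
     open U \<and> connected U \<and> U \<noteq> {} \<and> smooth_on U f \<and> smooth_on U N \<and>
     (\<forall>x\<in>U. f x \<in> space_form K \<and> inj (frechet_derivative f (at x)) \<and>
        N x \<in> space_form_tangent K (f x) \<and> ambient_form K (N x) (N x) = 1 \<and>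
        (\<forall>v. ambient_form K (frechet_derivative f (at x) v) (N x) = 0))"

definition principal_vector ::
  "real \<Rightarrow> (real^3 \<Rightarrow> ambient) \<Rightarrow> (real^3 \<Rightarrow> ambient) \<Rightarrow> real^3 \<Rightarrow> real \<Rightarrow> real^3 \<Rightarrow> bool" where
  "principal_vector K f N x \<kappa> v \<longleftrightarrow>
     v \<noteq> 0 \<and> (\<forall>w. second_form K f N x v w = \<kappa> * first_form K f x v w)"

definition principal_curvatures ::
  "real \<Rightarrow> (real^3 \<Rightarrow> ambient) \<Rightarrow> (real^3 \<Rightarrow> ambient) \<Rightarrow> real^3 \<Rightarrow> real set" where
  "principal_curvatures K f N x = {\<kappa>. \<exists>v. principal_vector K f N x \<kappa> v}"

definition generic_hypersurface ::
  "real \<Rightarrow> (real^3) set \<Rightarrow> (real^3 \<Rightarrow> ambient) \<Rightarrow> (real^3 \<Rightarrow> ambient) \<Rightarrow> bool" where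
  "generic_hypersurface K U f N \<longleftrightarrow>
     hypersurface K U f N \<and> (\<forall>x\<in>U. card (principal_curvatures K f N x) = 3)"

definition principal_coordinates ::
  "real \<Rightarrow> (real^3) set \<Rightarrow> (real^3 \<Rightarrow> ambient) \<Rightarrow> (real^3 \<Rightarrow> ambient) \<Rightarrow> bool" where
  "principal_coordinates K U f N \<longleftrightarrow>
     (\<forall>x\<in>U. \<forall>i. \<exists>\<kappa>. principal_vector K f N x \<kappa> (axis i 1))"

definition positive_definite_on :: "(real^3) set \<Rightarrow> bilinear_field \<Rightarrow> bool" where
  "positive_definite_on U g \<longleftrightarrow> (\<forall>x\<in>U. \<forall>v. v \<noteq> 0 \<longrightarrow> g x v v > 0)"

text \<open>
  Locally g is a positive multiple of the pullback of the Euclidean metric under \<psi>; when g is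
  positive definite, \<psi> is automatically a local diffeomorphism.
\<close>

definition conformally_flat_on :: "(real^3) set \<Rightarrow> bilinear_field \<Rightarrow> bool" where
  "conformally_flat_on U g \<longleftrightarrow>
     (\<forall>p\<in>U. \<exists>V \<psi> \<sigma>. open V \<and> p \<in> V \<and> V \<subseteq> U \<and>
        smooth_on V (\<psi> :: real^3 \<Rightarrow> real^3) \<and> smooth_on V (\<sigma> :: real^3 \<Rightarrow> real) \<and>
        (\<forall>x\<in>V. \<forall>u v. g x u v =
           exp (2 * \<sigma> x) * (frechet_derivative \<psi> (at x) u \<bullet> frechet_derivative \<psi> (at x) v)))"

text \<open>
  The metric exp (2 Q) (E1 dx1^2 + E2 dx2^2 + E3 dx3^2), as a field of bilinear forms.
\<close>

definition conformal_diagonal ::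
  "(real^3 \<Rightarrow> real) \<Rightarrow> (real^3 \<Rightarrow> real) \<Rightarrow> (real^3 \<Rightarrow> real) \<Rightarrow> (real^3 \<Rightarrow> real) \<Rightarrow> bilinear_field" where
  "conformal_diagonal Q E1 E2 E3 x u v =
     exp (2 * Q x) * (E1 x * u$1 * v$1 + E2 x * u$2 * v$2 + E3 x * u$3 * v$3)"

text \<open>
  No regularity of Q has to be required: Q is determined by the smooth induced metric and by l,
  so it is automatically smooth.
\<close>

definition associated_hypersurface ::
  "real \<Rightarrow> (real^3) set \<Rightarrow> (real^3 \<Rightarrow> ambient) \<Rightarrow> (real^3 \<Rightarrow> ambient) \<Rightarrow> (3 \<Rightarrow> real^3 \<Rightarrow> real) \<Rightarrow> bool" where
  "associated_hypersurface K U f N l \<longleftrightarrow>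
     lame_guichard U l \<and>
     generic_hypersurface K U f N \<and>
     conformally_flat_on U (first_form K f) \<and>
     principal_coordinates K U f N \<and>
     (\<exists>Q. \<forall>x\<in>U. first_form K f x =
        conformal_diagonal Q (\<lambda>y. (l 1 y)\<^sup>2) (\<lambda>y. (l 2 y)\<^sup>2) (\<lambda>y. (l 3 y)\<^sup>2) x)"

definition xi :: "(3 \<Rightarrow> real) \<Rightarrow> real^3 \<Rightarrow> real" where
  "xi \<alpha> x = (\<Sum>s\<in>UNIV. \<alpha> s * x$s)"

end

theory Submission
  imports Defs
begin

text \<open>
  Put \<phi> = arctan (l3 / l1). The Guichard condition gives cos \<phi> = l1 / l2 and sin \<phi> = l3 / l2,
  so the trigonometric form of the metric holds with e^(2P) = e^(2Q) l2^2. The system l_i' = c_i l_j l_k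
  and c1 l3^2 = c3 l1^2 - \<lambda> give \<phi>' = \<lambda> / l2, while c1 l2^2 = c2 l1^2 - \<lambda> gives
  \<lambda> / l2^2 = c2 cos^2 \<phi> - c1. Hence \<phi>'^2 = \<lambda> (c2 cos^2 \<phi> - c1). Here \<lambda> is nonzero: otherwise
  c1, c2, c3 would have the same sign, contradicting the relation between the \<alpha>_s and the c_s.
  So the hyperbolic form of the metric is never needed.
\<close>

lemma linear_xi: "linear (xi \<alpha>)"
  by (rule linearI) (simp_all add: xi_def algebra_simps sum.distrib sum_distrib_left)

text \<open>A linear form with a nonzero coefficient \<open>\<alpha> s\<close> is onto, since it
  takes every value on the \<open>s\<close>-th coordinate axis, and surjective linear maps are
  open.\<close>

lemma open_xi_image:
  assumes "open U" "\<alpha> s \<noteq> 0"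
  shows "open (xi \<alpha> ` U)"
proof (rule open_surjective_linear_image[OF assms(1) linear_xi])
  have "xi \<alpha> (axis s (t / \<alpha> s)) = t" for t
    using assms(2) by (simp add: xi_def axis_def if_distrib cong: if_cong)
  then show "surj (xi \<alpha>)" by (rule surjI)
qed

text \<open>The metric is quadratic in the first derivatives of \<open>f\<close>, so second-order
  smoothness gives differentiability. The direction \<open>b\<close> is a basis vector because
  \<open>Ck_on\<close> controls derivatives along these.\<close>

lemma first_form_differentiable:
  assumes f: "smooth_on U f" and b: "b \<in> Basis" and x: "x \<in> U"
  shows "(\<lambda>y. first_form K f y b b) differentiable (at x)"
proof -
  let ?D = "\<lambda>y. frechet_derivative f (at y) b"
  have "Ck_on (Suc (Suc 0)) U f" using f unfolding smooth_on_def by blast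
  then have "?D differentiable (at x)" using b x by simp
  then obtain D' where D: "(?D has_derivative D') (at x)"
    unfolding differentiable_def by blast
  have "(\<lambda>y. fst (?D y)) differentiable (at x)" "(\<lambda>y. snd (?D y)) differentiable (at x)"
    using has_derivative_fst[OF D] has_derivative_snd[OF D] unfolding differentiable_def by blast+
  \<comment> \<open>Division by \<open>K\<close> becomes multiplication by the constant
    \<open>inverse K\<close>, which also covers the flat case \<open>K = 0\<close> without a case
    split.\<close>
  then show ?thesis
    unfolding first_form_def ambient_form_def divide_inverse by simp
qed

lemma conformal_diagonal_positive_definite_on:
  assumes "\<And>x. x \<in> U \<Longrightarrow> E1 x > 0" "\<And>x. x \<in> U \<Longrightarrow> E2 x > 0" "\<And>x. x \<in> U \<Longrightarrow> E3 x > 0"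
  shows "positive_definite_on U (conformal_diagonal Q E1 E2 E3)"
  unfolding positive_definite_on_def
proof (intro ballI allI impI)
  fix x v assume x: "x \<in> U" and v: "(v :: real^3) \<noteq> 0"
  let ?T1 = "E1 x * v$1 * v$1" and ?T2 = "E2 x * v$2 * v$2" and ?T3 = "E3 x * v$3 * v$3"
  have ge: "?T1 \<ge> 0" "?T2 \<ge> 0" "?T3 \<ge> 0"
    using assms x by (simp_all add: mult.assoc less_imp_le)
  from v have "v$1 \<noteq> 0 \<or> v$2 \<noteq> 0 \<or> v$3 \<noteq> 0"
    by (auto simp: vec_eq_iff forall_3)
  then have "?T1 \<noteq> 0 \<or> ?T2 \<noteq> 0 \<or> ?T3 \<noteq> 0"
    using assms[OF x] by auto
  with ge have "?T1 + ?T2 + ?T3 > 0" by linarith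
  then show "conformal_diagonal Q E1 E2 E3 x v v > 0"
    unfolding conformal_diagonal_def by simp
qed

text \<open>In a right triangle with hypotenuse \<open>q\<close> and legs \<open>p\<close> and
  \<open>r\<close>, the angle between \<open>p\<close> and \<open>q\<close> is
  \<open>arctan (r / p)\<close>. The squared formulas hold for either sign of
  \<open>r\<close>.\<close>

lemma
  fixes p q r :: real
  assumes "p > 0" "q > 0" "q\<^sup>2 = p\<^sup>2 + r\<^sup>2"
  shows cos_arctan_leg: "(cos (arctan (r / p)))\<^sup>2 = p\<^sup>2 / q\<^sup>2"
    and sin_arctan_leg: "(sin (arctan (r / p)))\<^sup>2 = r\<^sup>2 / q\<^sup>2"
proof -
  have "1 + (r / p)\<^sup>2 = q\<^sup>2 / p\<^sup>2"
    using assms by (simp add: power_divide field_simps)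
  then show cos: "(cos (arctan (r / p)))\<^sup>2 = p\<^sup>2 / q\<^sup>2"
    by (simp add: cos_arctan power_divide real_sqrt_divide)
  have "(sin (arctan (r / p)))\<^sup>2 = 1 - p\<^sup>2 / q\<^sup>2"
    using cos sin_squared_eq by metis
  then show "(sin (arctan (r / p)))\<^sup>2 = r\<^sup>2 / q\<^sup>2"
    using assms by (simp add: field_simps)
qed

text \<open>The quotient rule gives
  \<open>(r / p)' = q * (b * p\<^sup>2 - a * r\<^sup>2) / p\<^sup>2\<close>, and the arctangent
  contributes the factor \<open>p\<^sup>2 / q\<^sup>2\<close> by the Pythagorean relation.\<close>

lemma angle_derivative:
  fixes p q r :: "real \<Rightarrow> real"
  assumes p: "(p has_real_derivative a * q t * r t) (at t)"
    and r: "(r has_real_derivative b * p t * q t) (at t)"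
    and pos: "p t > 0" "q t > 0" and pyth: "(q t)\<^sup>2 = (p t)\<^sup>2 + (r t)\<^sup>2"
  shows "((\<lambda>s. arctan (r s / p s)) has_real_derivative (b * (p t)\<^sup>2 - a * (r t)\<^sup>2) / q t) (at t)"
proof -
  have "1 + (r t / p t)\<^sup>2 = (q t)\<^sup>2 / (p t)\<^sup>2"
    using pos pyth by (simp add: power_divide field_simps)
  then have "inverse (1 + (r t / p t)\<^sup>2) *
      ((b * p t * q t * p t - r t * (a * q t * r t)) / (p t * p t)) =
      (b * (p t)\<^sup>2 - a * (r t)\<^sup>2) / q t"
    using pos by (simp add: field_simps power2_eq_square)
  moreover have "((\<lambda>s. arctan (r s / p s)) has_real_derivative
      inverse (1 + (r t / p t)\<^sup>2) *
      ((b * p t * q t * p t - r t * (a * q t * r t)) / (p t * p t))) (at t)"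
    using pos by (intro DERIV_chain2[OF DERIV_arctan] DERIV_divide[OF r p]) auto
  ultimately show ?thesis by simp
qed

theorem theorem10:
  fixes K lam :: real
    and U :: "(real^3) set"
    and f N :: "real^3 \<Rightarrow> ambient"
    and l :: "3 \<Rightarrow> real \<Rightarrow> real"
    and c \<alpha> :: "3 \<Rightarrow> real"
    and I :: "real set"
  assumes assoc: "associated_hypersurface K U f N (\<lambda>i x. l i (xi \<alpha> x))"
    and I: "I = xi \<alpha> ` U"
    and \<alpha>: "\<And>s. \<alpha> s \<noteq> 0"
    and nonconst: "\<And>i. \<not> l i constant_on I"
    and c: "\<And>i. c i \<noteq> 0"
    and l_deriv: "\<And>i j k t. i \<noteq> j \<Longrightarrow> j \<noteq> k \<Longrightarrow> i \<noteq> k \<Longrightarrow> t \<in> I \<Longrightarrow>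
                    (l i has_real_derivative c i * l j t * l k t) (at t)"
    and c_sum: "c 1 - c 2 + c 3 = 0"
    and \<alpha>_c: "(\<alpha> 1)\<^sup>2 * c 2 * c 3 + (\<alpha> 2)\<^sup>2 * c 1 * c 3 + (\<alpha> 3)\<^sup>2 * c 1 * c 2 = 0"
    and l1: "\<And>t. t \<in> I \<Longrightarrow> (deriv (l 1) t)\<^sup>2 =
               c 2 * (c 2 - c 1) * ((l 1 t)\<^sup>2 - lam / c 2) * ((l 1 t)\<^sup>2 - lam / (c 2 - c 1))"
    and l2: "\<And>t. t \<in> I \<Longrightarrow> (l 2 t)\<^sup>2 = c 2 / c 1 * ((l 1 t)\<^sup>2 - lam / c 2)"
    and l3: "\<And>t. t \<in> I \<Longrightarrow> (l 3 t)\<^sup>2 = (c 2 - c 1) / c 1 * ((l 1 t)\<^sup>2 - lam / (c 2 - c 1))"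
  shows "open I \<and> is_interval I \<and> positive_definite_on U (first_form K f) \<and>
    ((\<exists>\<phi> P a b d. P differentiable_on U \<and> a \<noteq> 0 \<and> b \<noteq> 0 \<and> d \<noteq> 0 \<and>
        (\<forall>x\<in>U. first_form K f x =
           conformal_diagonal P (\<lambda>y. (cos (\<phi> (xi \<alpha> y)))\<^sup>2) (\<lambda>y. 1) (\<lambda>y. (sin (\<phi> (xi \<alpha> y)))\<^sup>2) x) \<and>
        (\<forall>t\<in>I. \<phi> field_differentiable (at t) \<and>
           (deriv \<phi> t)\<^sup>2 = d * (a * (cos (\<phi> t))\<^sup>2 - b)))
     \<or>
     (\<exists>\<phi> P a b d. P differentiable_on U \<and> a \<noteq> 0 \<and> b \<noteq> 0 \<and> d \<noteq> 0 \<and>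
        (\<forall>x\<in>U. first_form K f x =
           conformal_diagonal P (\<lambda>y. (sinh (\<phi> (xi \<alpha> y)))\<^sup>2) (\<lambda>y. (cosh (\<phi> (xi \<alpha> y)))\<^sup>2) (\<lambda>y. 1) x) \<and>
        (\<forall>t\<in>I. \<phi> field_differentiable (at t) \<and>
           (deriv \<phi> t)\<^sup>2 = d * (a * (cosh (\<phi> t))\<^sup>2 - b))))"
proof -
  let ?L = "\<lambda>i x. l i (xi \<alpha> x)"
  have hyp: "hypersurface K U f N" and lg: "lame_guichard U ?L"
    using assoc unfolding associated_hypersurface_def generic_hypersurface_def by auto
  then have U: "open U" "connected U" "U \<noteq> {}" and f: "smooth_on U f"
    unfolding hypersurface_def by auto
  obtain Q where Q: "\<And>x. x \<in> U \<Longrightarrow> first_form K f x =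
        conformal_diagonal Q (\<lambda>y. (?L 1 y)\<^sup>2) (\<lambda>y. (?L 2 y)\<^sup>2) (\<lambda>y. (?L 3 y)\<^sup>2) x"
    using assoc unfolding associated_hypersurface_def by auto
  have pos: "l i t > 0" if "t \<in> I" for i t
    using lg that I unfolding lame_guichard_def by auto
  have pyth: "(l 2 t)\<^sup>2 = (l 1 t)\<^sup>2 + (l 3 t)\<^sup>2" if "t \<in> I" for t
    using lg that I unfolding lame_guichard_def by fastforce
  \<comment> \<open>This identifies the denominator \<open>c 2 - c 1\<close> in the formula for
    \<open>l 3\<close> as the nonzero constant \<open>c 3\<close>, so it can be cleared in
    \<open>L3\<close>.\<close>
  have c3: "c 3 = c 2 - c 1" using c_sum by simp
  have L2: "c 1 * (l 2 t)\<^sup>2 = c 2 * (l 1 t)\<^sup>2 - lam" if "t \<in> I" for t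
    unfolding l2[OF that] using c[of 1] c[of 2] by (simp add: right_diff_distrib)
  have L3: "c 1 * (l 3 t)\<^sup>2 = c 3 * (l 1 t)\<^sup>2 - lam" if "t \<in> I" for t
    unfolding l3[OF that] c3[symmetric] using c[of 1] c[of 3] by (simp add: right_diff_distrib)

  have "lam \<noteq> 0"
  proof
    assume "lam = 0"
    obtain t where t: "t \<in> I" using U(3) I by auto
    \<comment> \<open>Multiplying \<open>L2\<close> and \<open>L3\<close> by \<open>c 1\<close>
      turns the sides with \<open>l 2\<close> and \<open>l 3\<close> into squares, which fixes the
      signs of \<open>c 1 * c 2\<close> and \<open>c 1 * c 3\<close>.\<close>
    have "c 2 * c 1 * (l 1 t)\<^sup>2 = (c 1 * l 2 t)\<^sup>2" "c 3 * c 1 * (l 1 t)\<^sup>2 = (c 1 * l 3 t)\<^sup>2"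
      using L2[OF t] L3[OF t] \<open>lam = 0\<close> by (simp_all add: power2_eq_square algebra_simps)
    moreover have "(c 1 * l 2 t)\<^sup>2 > 0" "(c 1 * l 3 t)\<^sup>2 > 0" "(l 1 t)\<^sup>2 > 0"
      using c[of 1] pos[OF t] by (simp_all add: less_imp_neq[symmetric])
    ultimately have c21: "c 1 * c 2 > 0" and c31: "c 1 * c 3 > 0"
      by (metis mult.commute zero_less_mult_pos2)+
    then have "c 2 * c 3 > 0" by (auto simp: zero_less_mult_iff)
    with c21 c31 have "(\<alpha> 1)\<^sup>2 * (c 2 * c 3) + (\<alpha> 2)\<^sup>2 * (c 1 * c 3) + (\<alpha> 3)\<^sup>2 * (c 1 * c 2) > 0"
      by (simp add: \<alpha> add_pos_pos)
    with \<alpha>_c show False by (simp add: mult.assoc)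
  qed

  define \<phi> where "\<phi> t = arctan (l 3 t / l 1 t)" for t
  have cos_\<phi>: "(cos (\<phi> t))\<^sup>2 = (l 1 t)\<^sup>2 / (l 2 t)\<^sup>2"
    and sin_\<phi>: "(sin (\<phi> t))\<^sup>2 = (l 3 t)\<^sup>2 / (l 2 t)\<^sup>2" if "t \<in> I" for t
    unfolding \<phi>_def using cos_arctan_leg sin_arctan_leg pos pyth that by blast+
  have \<phi>': "(\<phi> has_real_derivative lam / l 2 t) (at t)" if t: "t \<in> I" for t
  proof -
    have "(l 1 has_real_derivative c 1 * l 2 t * l 3 t) (at t)"
      "(l 3 has_real_derivative c 3 * l 1 t * l 2 t) (at t)"
      by (rule l_deriv; use t in simp)+
    \<comment> \<open>The numerator supplied by the lemma is
      \<open>c 3 * (l 1 t)\<^sup>2 - c 1 * (l 3 t)\<^sup>2\<close>, which equals the constant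
      \<open>lam\<close> by \<open>L3\<close>.\<close>
    from angle_derivative[where p = "l 1" and q = "l 2" and r = "l 3",
        OF this pos[OF t] pos[OF t] pyth[OF t]] show ?thesis
      unfolding \<phi>_def using L3[OF t] by simp
  qed
  have ode: "\<phi> field_differentiable (at t) \<and> (deriv \<phi> t)\<^sup>2 = lam * (c 2 * (cos (\<phi> t))\<^sup>2 - c 1)"
    if t: "t \<in> I" for t
  proof
    show "\<phi> field_differentiable (at t)"
      using \<phi>'[OF t] by (auto simp: field_differentiable_def)
    \<comment> \<open>This is \<open>L2\<close> divided by \<open>(l 2 t)\<^sup>2\<close>. Of the
      two factors \<open>lam\<close> in the squared derivative, one is absorbed here and the other
      stays as the outer constant of the equation.\<close>
    have "c 2 * (cos (\<phi> t))\<^sup>2 - c 1 = lam / (l 2 t)\<^sup>2"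
      using L2[OF t] pos[OF t, of 2] by (simp add: cos_\<phi>[OF t] field_simps)
    then show "(deriv \<phi> t)\<^sup>2 = lam * (c 2 * (cos (\<phi> t))\<^sup>2 - c 1)"
      using DERIV_imp_deriv[OF \<phi>'[OF t]] by (simp add: power_divide power2_eq_square)
  qed

  \<comment> \<open>Reading P off the metric coefficient of dx2^2 shows its differentiability,
    which is not assumed of Q.\<close>
  define G where "G x = first_form K f x (axis 2 1) (axis 2 1)" for x
  define P where "P x = ln (G x) / 2" for x
  have G: "G x = exp (2 * Q x) * (?L 2 x)\<^sup>2" if "x \<in> U" for x
    unfolding G_def Q[OF that] conformal_diagonal_def by (simp add: axis_def)
  have posU: "?L i x > 0" if "x \<in> U" for i x
    using pos I that by blast
  have G_pos: "G x > 0" if "x \<in> U" for x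
    using G[OF that] posU[OF that, of 2] by simp
  have "P differentiable (at x)" if x: "x \<in> U" for x
  proof -
    have "G differentiable (at x)"
      unfolding G_def by (rule first_form_differentiable[OF f _ x]) (simp add: axis_in_Basis_iff)
    then obtain G' where "(G has_derivative G') (at x)"
      unfolding differentiable_def by blast
    from has_derivative_ln[OF G_pos[OF x] this]
    have "(\<lambda>x. ln (G x)) differentiable (at x)"
      unfolding differentiable_def by blast
    then show ?thesis
      unfolding P_def divide_inverse by simp
  qed
  then have P: "P differentiable_on U"
    by (simp add: differentiable_at_imp_differentiable_on)

  have metric: "first_form K f x =
      conformal_diagonal P (\<lambda>y. (cos (\<phi> (xi \<alpha> y)))\<^sup>2) (\<lambda>y. 1) (\<lambda>y. (sin (\<phi> (xi \<alpha> y)))\<^sup>2) x"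
    if x: "x \<in> U" for x
  proof (intro ext)
    fix u v
    have t: "xi \<alpha> x \<in> I" using x I by blast
    \<comment> \<open>The new conformal factor absorbs \<open>(l 2)\<^sup>2\<close>, so the
      coefficients become the quotients \<open>(l i)\<^sup>2 / (l 2)\<^sup>2\<close>, that is
      \<open>cos\<^sup>2\<close>, \<open>1\<close> and \<open>sin\<^sup>2\<close> of the
      angle.\<close>
    have "exp (2 * P x) = exp (2 * Q x) * (?L 2 x)\<^sup>2"
      using G_pos[OF x] G[OF x] by (simp add: P_def)
    then show "first_form K f x u v =
      conformal_diagonal P (\<lambda>y. (cos (\<phi> (xi \<alpha> y)))\<^sup>2) (\<lambda>y. 1) (\<lambda>y. (sin (\<phi> (xi \<alpha> y)))\<^sup>2) x u v"
      using posU[OF x, of 2]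
      by (simp add: Q[OF x] conformal_diagonal_def cos_\<phi>[OF t] sin_\<phi>[OF t] field_simps)
  qed

  have "open I"
    unfolding I using U(1) \<alpha> by (rule open_xi_image)
  moreover have "is_interval I"
    unfolding I is_interval_connected_1
    by (intro connected_continuous_image linear_continuous_on linear_conv_bounded_linear[THEN iffD1]
        linear_xi U(2))
  moreover have "positive_definite_on U (first_form K f)"
  proof -
    \<comment> \<open>In the form with \<open>Q\<close> the coefficients are squares of positive
      functions; in the trigonometric form one would first have to show that sine and cosine do not
      vanish.\<close>
    have "positive_definite_on U
        (conformal_diagonal Q (\<lambda>y. (?L 1 y)\<^sup>2) (\<lambda>y. (?L 2 y)\<^sup>2) (\<lambda>y. (?L 3 y)\<^sup>2))"
      by (rule conformal_diagonal_positive_definite_on) (intro zero_less_power posU; assumption)+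
    then show ?thesis
      by (simp add: positive_definite_on_def Q)
  qed
  ultimately show ?thesis
    \<comment> \<open>The witnesses \<open>a = c 2\<close>, \<open>b = c 1\<close>,
      \<open>d = lam\<close> are read off from \<open>ode\<close>.\<close>
    by (intro conjI disjI1 exI[of _ \<phi>] exI[of _ P] exI[of _ "c 2"] exI[of _ "c 1"] exI[of _ lam])
      (use P metric ode \<open>lam \<noteq> 0\<close> c in simp_all)
qed

end
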